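(* Let $(\mathcal{X},\mathbf{h})$ be an almost representable polymatroid, let $0\le\epsilon\le\mathbf{h}(\mathcal{X})$, and define $\mathbf{g}(\mathcal{A})=\min\big(\mathbf{h}(\mathcal{A}),\ \mathbf{h}(\mathcal{X})-\epsilon\big)$ for all $\mathcal{A}\subseteq\mathcal{X}$. Then $\mathbf{g}$ is almost representable.
   Context: A polymatroid $(\mathcal{X},\mathbf{h})$ is a finite ground set $\mathcal{X}=\{X_1,\dots,X_n\}$ with $\mathbf{h}:2^{\mathcal{X}}\to\mathbb{R}_{\ge0}$ satisfying $\mathbf{h}(\emptyset)=0$, monotonicity and submodularity. It is representable if for some finite field $\mathbb{F}_q$ there are subspaces $V_1,\dots,V_n$ of an $\mathbb{F}_q$-vector space with $\mathbf{h}(\{X_i:i\in\alpha\})=\dim\langle V_i:i\in\alpha\rangle$ for all $\alpha\subseteq\{1,\dots,n\}$. Rank functions are viewed as vectors in $\mathbb{R}^{2^{|\mathcal{X}|}}$. A function $\mathbf{h}$ is almost representable if $\mathbf{h}=\lim_{i\to\infty}c_i\mathbf{g}_i$ for some representable rank functions $\mathbf{g}_i$ on $\mathcal{X}$ and positive reals $c_i$. *)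

theory Defs
  imports Complex_Main "HOL-Algebra.Ring" "HOL-Algebra.FiniteProduct"
begin

text \<open>A rank function on a finite ground set X is a map from subsets of X to the reals;
  we use functions on all sets of type 'x set, only their values on subsets of X matter.\<close>

definition polymatroid :: "'x set \<Rightarrow> ('x set \<Rightarrow> real) \<Rightarrow> bool" where
  "polymatroid X h \<longleftrightarrow> finite X \<and> h {} = 0 \<and>
     (\<forall>A. A \<subseteq> X \<longrightarrow> h A \<ge> 0) \<and>
     (\<forall>A B. A \<subseteq> B \<and> B \<subseteq> X \<longrightarrow> h A \<le> h B) \<and>
     (\<forall>A B. A \<subseteq> X \<and> B \<subseteq> X \<longrightarrow> h (A \<union> B) + h (A \<inter> B) \<le> h A + h B)"

definition fvec :: "('a, 'b) ring_scheme \<Rightarrow> nat \<Rightarrow> (nat \<Rightarrow> 'a) set" where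
  "fvec F m = {v. (\<forall>i<m. v i \<in> carrier F) \<and> (\<forall>i\<ge>m. v i = \<zero>\<^bsub>F\<^esub>)}"

definition lincomb :: "('a, 'b) ring_scheme \<Rightarrow> ((nat \<Rightarrow> 'a) \<Rightarrow> 'a) \<Rightarrow> (nat \<Rightarrow> 'a) set \<Rightarrow> (nat \<Rightarrow> 'a)" where
  "lincomb F c S = (\<lambda>i. finsum F (\<lambda>v. c v \<otimes>\<^bsub>F\<^esub> v i) S)"

definition fspan :: "('a, 'b) ring_scheme \<Rightarrow> (nat \<Rightarrow> 'a) set \<Rightarrow> (nat \<Rightarrow> 'a) set" where
  "fspan F S = {lincomb F c T | c T. finite T \<and> T \<subseteq> S \<and> c \<in> T \<rightarrow> carrier F}"

definition lin_indep :: "('a, 'b) ring_scheme \<Rightarrow> (nat \<Rightarrow> 'a) set \<Rightarrow> bool" where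
  "lin_indep F S \<longleftrightarrow> finite S \<and>
     (\<forall>c \<in> S \<rightarrow> carrier F. lincomb F c S = (\<lambda>i. \<zero>\<^bsub>F\<^esub>) \<longrightarrow> (\<forall>v\<in>S. c v = \<zero>\<^bsub>F\<^esub>))"

definition vdim :: "('a, 'b) ring_scheme \<Rightarrow> (nat \<Rightarrow> 'a) set \<Rightarrow> nat" where
  "vdim F W = Max {card T | T. T \<subseteq> W \<and> lin_indep F T}"

definition fsubspace :: "('a, 'b) ring_scheme \<Rightarrow> nat \<Rightarrow> (nat \<Rightarrow> 'a) set \<Rightarrow> bool" where
  "fsubspace F m V \<longleftrightarrow> V \<subseteq> fvec F m \<and> (\<lambda>i. \<zero>\<^bsub>F\<^esub>) \<in> V \<and>
     (\<forall>u\<in>V. \<forall>v\<in>V. (\<lambda>i. u i \<oplus>\<^bsub>F\<^esub> v i) \<in> V) \<and>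
     (\<forall>a\<in>carrier F. \<forall>v\<in>V. (\<lambda>i. a \<otimes>\<^bsub>F\<^esub> v i) \<in> V)"

text \<open>Every finite field is isomorphic to one whose carrier is a set of naturals, and every
  finite-dimensional vector space over F is isomorphic to some F^m, so quantifying over
  fields with carrier in nat and ambient spaces F^m loses no generality.\<close>

definition representable :: "'x set \<Rightarrow> ('x set \<Rightarrow> real) \<Rightarrow> bool" where
  "representable X g \<longleftrightarrow>
     (\<exists>(F :: nat ring) (m :: nat) (V :: 'x \<Rightarrow> (nat \<Rightarrow> nat) set).
        field F \<and> finite (carrier F) \<and>
        (\<forall>x\<in>X. fsubspace F m (V x)) \<and>
        (\<forall>A. A \<subseteq> X \<longrightarrow> g A = real (vdim F (fspan F (\<Union>x\<in>A. V x)))))"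

definition almost_representable :: "'x set \<Rightarrow> ('x set \<Rightarrow> real) \<Rightarrow> bool" where
  "almost_representable X h \<longleftrightarrow>
     (\<exists>(g :: nat \<Rightarrow> 'x set \<Rightarrow> real) (c :: nat \<Rightarrow> real).
        (\<forall>i. representable X (g i)) \<and> (\<forall>i. c i > 0) \<and>
        (\<forall>A. A \<subseteq> X \<longrightarrow> (\<lambda>i. c i * g i A) \<longlonglongrightarrow> h A))"

end

theory Submission
  imports Defs
begin

text \<open>Exact truncation of a representable rank function needs a generic vector, hence a large field.
  Over the given field one can still truncate up to an additive error \<open>n = |X|\<close>: repeatedly divide out
  a vector that avoids every span of codimension greater than \<open>n\<close>. Such a vector exists because at
  most \<open>2\<^sup>n\<close> spans have to be avoided. Applying this to \<open>N\<^sub>i\<close> copies of the \<open>i\<close>-th approximating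
  representation and scaling by \<open>c\<^sub>i / N\<^sub>i \<rightarrow> 0\<close> makes the error vanish in the limit.\<close>

section \<open>Linear combinations, subspaces and spans over a finite field\<close>

text \<open>A finite field makes every subspace of \<open>fvec F m\<close> finite, so dimensions can
  be read off from cardinalities and vectors in general position can be found by counting.\<close>

locale fin_field = field F for F :: "('a, 'b) ring_scheme" (structure) +
  assumes finite_carrier: "finite (carrier F)"
begin

lemma fvecD: "v \<in> fvec F m \<Longrightarrow> v i \<in> carrier F"
  unfolding fvec_def by (cases "i < m") auto

lemma finite_fvec: "finite (fvec F m)"
proof (rule finite_subset)
  show "fvec F m \<subseteq> (\<lambda>f i. if i < m then f i else \<zero>) ` ({..<m} \<rightarrow>\<^sub>E carrier F)"
  proof
    fix v assume v: "v \<in> fvec F m"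
    have "v = (\<lambda>i. if i < m then restrict v {..<m} i else \<zero>)"
      using v by (auto simp: fvec_def fun_eq_iff)
    moreover have "restrict v {..<m} \<in> {..<m} \<rightarrow>\<^sub>E carrier F"
      using v by (auto simp: fvec_def)
    ultimately show "v \<in> (\<lambda>f i. if i < m then f i else \<zero>) ` ({..<m} \<rightarrow>\<^sub>E carrier F)"
      by blast
  qed
  show "finite ((\<lambda>f i. if i < m then f i else \<zero>) ` ({..<m} \<rightarrow>\<^sub>E carrier F))"
    by (intro finite_imageI finite_PiE) (auto simp: finite_carrier)
qed

lemma fsubspaceD:
  assumes "fsubspace F m S"
  shows "S \<subseteq> fvec F m" "(\<lambda>i. \<zero>) \<in> S" "finite S"
    and "\<And>u v. u \<in> S \<Longrightarrow> v \<in> S \<Longrightarrow> (\<lambda>i. u i \<oplus> v i) \<in> S"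
    and "\<And>a v. a \<in> carrier F \<Longrightarrow> v \<in> S \<Longrightarrow> (\<lambda>i. a \<otimes> v i) \<in> S"
    and "\<And>v i. v \<in> S \<Longrightarrow> v i \<in> carrier F"
  using assms finite_subset[OF _ finite_fvec] fvecD unfolding fsubspace_def by blast+

lemma fsubspace_fvec: "fsubspace F m (fvec F m)"
  unfolding fsubspace_def by (auto simp: fvec_def)

lemma lincomb_insert:
  assumes "finite T" "v \<notin> T" "insert v T \<subseteq> fvec F m" "c \<in> insert v T \<rightarrow> carrier F"
  shows "lincomb F c (insert v T) = (\<lambda>i. c v \<otimes> v i \<oplus> lincomb F c T i)"
proof
  fix i
  have "c w \<otimes> w i \<in> carrier F" if "w \<in> insert v T" for w
  proof -
    have "w \<in> fvec F m" "c w \<in> carrier F" using assms that by auto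
    then show ?thesis using fvecD by simp
  qed
  then show "lincomb F c (insert v T) i = c v \<otimes> v i \<oplus> lincomb F c T i"
    unfolding lincomb_def using assms(1,2) by (subst finsum_insert) auto
qed

lemma lincomb_empty: "lincomb F c {} = (\<lambda>i. \<zero>)"
  unfolding lincomb_def by simp

lemma lincomb_mem_fsubspace:
  assumes "fsubspace F m S" "finite T" "T \<subseteq> S" "c \<in> T \<rightarrow> carrier F"
  shows "lincomb F c T \<in> S"
  using assms(2-)
proof (induction T rule: finite_induct)
  case empty
  then show ?case using fsubspaceD[OF assms(1)] by (simp add: lincomb_empty)
next
  case (insert v T)
  have "insert v T \<subseteq> fvec F m"
    using insert.prems fsubspaceD(1)[OF assms(1)] by blast
  then have "lincomb F c (insert v T) = (\<lambda>i. c v \<otimes> v i \<oplus> lincomb F c T i)"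
    using insert by (intro lincomb_insert) auto
  moreover have "lincomb F c T \<in> S" using insert by auto
  moreover have "(\<lambda>i. c v \<otimes> v i) \<in> S"
    using insert.prems fsubspaceD(5)[OF assms(1)] by auto
  ultimately show ?case using fsubspaceD(4)[OF assms(1)] by simp
qed

lemma lincomb_closed:
  assumes "finite T" "T \<subseteq> fvec F m" "c \<in> T \<rightarrow> carrier F"
  shows "lincomb F c T i \<in> carrier F"
  using lincomb_mem_fsubspace[OF fsubspace_fvec assms] by (rule fvecD)

text \<open>Padding with zero coefficients does not change the sum. It brings combinations over
  different sets to a common index set, where they can be added or compared.\<close>

lemma lincomb_extend:
  assumes "finite U" "T \<subseteq> U" "U \<subseteq> fvec F m" "c \<in> T \<rightarrow> carrier F"
  shows "lincomb F c T = lincomb F (\<lambda>v. if v \<in> T then c v else \<zero>) U"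
proof
  fix i
  have *: "w i \<in> carrier F" if "w \<in> U" for w using assms that fvecD by blast
  show "lincomb F c T i = lincomb F (\<lambda>v. if v \<in> T then c v else \<zero>) U i"
    unfolding lincomb_def
    using assms * by (intro add.finprod_mono_neutral_cong_left) (auto simp: Pi_iff)
qed

lemma lincomb_add:
  assumes "finite T" "T \<subseteq> fvec F m" "c \<in> T \<rightarrow> carrier F" "d \<in> T \<rightarrow> carrier F"
  shows "lincomb F (\<lambda>v. c v \<oplus> d v) T = (\<lambda>i. lincomb F c T i \<oplus> lincomb F d T i)"
proof
  fix i
  have *: "w i \<in> carrier F" if "w \<in> T" for w using assms that fvecD by blast
  have "lincomb F (\<lambda>v. c v \<oplus> d v) T i = (\<Oplus>v\<in>T. c v \<otimes> v i \<oplus> d v \<otimes> v i)"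
    unfolding lincomb_def using assms * by (intro finsum_cong') (auto simp: l_distr Pi_iff)
  also have "\<dots> = lincomb F c T i \<oplus> lincomb F d T i"
    unfolding lincomb_def using assms * by (intro finsum_addf) (auto simp: Pi_iff)
  finally show "lincomb F (\<lambda>v. c v \<oplus> d v) T i = lincomb F c T i \<oplus> lincomb F d T i" .
qed

lemma lincomb_scale:
  assumes "finite T" "T \<subseteq> fvec F m" "c \<in> T \<rightarrow> carrier F" "a \<in> carrier F"
  shows "lincomb F (\<lambda>v. a \<otimes> c v) T = (\<lambda>i. a \<otimes> lincomb F c T i)"
proof
  fix i
  have *: "w i \<in> carrier F" if "w \<in> T" for w using assms that fvecD by blast
  have "lincomb F (\<lambda>v. a \<otimes> c v) T i = (\<Oplus>v\<in>T. a \<otimes> (c v \<otimes> v i))"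
    unfolding lincomb_def using assms * by (intro finsum_cong') (auto simp: m_assoc Pi_iff)
  also have "\<dots> = a \<otimes> lincomb F c T i"
    unfolding lincomb_def using assms * by (intro finsum_rdistr[symmetric]) (auto simp: Pi_iff)
  finally show "lincomb F (\<lambda>v. a \<otimes> c v) T i = a \<otimes> lincomb F c T i" .
qed

text \<open>This is the way to bound a span from above: exhibit a subspace, often an image or a
  preimage under a linear map, that contains the generators.\<close>

lemma fspan_minimal:
  assumes "fsubspace F m S" "B \<subseteq> S"
  shows "fspan F B \<subseteq> S"
  using lincomb_mem_fsubspace[OF assms(1)] assms(2) unfolding fspan_def by blast

lemma fspan_superset:
  assumes "B \<subseteq> fvec F m"
  shows "B \<subseteq> fspan F B"
proof
  fix v assume v: "v \<in> B"
  then have "\<And>i. v i \<in> carrier F" using assms fvecD by blast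
  then have "lincomb F (\<lambda>_. \<one>) {v} = v"
    unfolding lincomb_def by (simp add: fun_eq_iff)
  then show "v \<in> fspan F B"
    unfolding fspan_def using v by (intro CollectI exI[of _ "\<lambda>_. \<one>"] exI[of _ "{v}"]) auto
qed

lemma fspan_mono:
  assumes "B \<subseteq> C"
  shows "fspan F B \<subseteq> fspan F C"
proof
  fix v assume "v \<in> fspan F B"
  then obtain c T where "v = lincomb F c T" "finite T" "T \<subseteq> B" "c \<in> T \<rightarrow> carrier F"
    unfolding fspan_def by blast
  then show "v \<in> fspan F C"
    unfolding fspan_def using assms by (intro CollectI exI[of _ c] exI[of _ T]) simp
qed

lemma fsubspace_fspan:
  assumes "B \<subseteq> fvec F m"
  shows "fsubspace F m (fspan F B)"
  unfolding fsubspace_def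
proof (intro conjI ballI)
  show "fspan F B \<subseteq> fvec F m" using fspan_minimal[OF fsubspace_fvec assms] .
  have "lincomb F (\<lambda>_. \<one>) {} \<in> fspan F B" unfolding fspan_def by blast
  then show "(\<lambda>i. \<zero>) \<in> fspan F B" by (simp add: lincomb_empty)
next
  fix u v assume "u \<in> fspan F B" "v \<in> fspan F B"
  then obtain c T d U where T: "u = lincomb F c T" "finite T" "T \<subseteq> B" "c \<in> T \<rightarrow> carrier F"
    and U: "v = lincomb F d U" "finite U" "U \<subseteq> B" "d \<in> U \<rightarrow> carrier F"
    unfolding fspan_def by blast
  \<comment> \<open>Both coefficient functions are padded with zeros to the union of the two
    supports, so that they can be added pointwise.\<close>
  let ?c = "\<lambda>v. if v \<in> T then c v else \<zero>" and ?d = "\<lambda>v. if v \<in> U then d v else \<zero>"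
  have cd: "?c \<in> T \<union> U \<rightarrow> carrier F" "?d \<in> T \<union> U \<rightarrow> carrier F" using T(4) U(4) by auto
  have sub: "finite (T \<union> U)" "T \<union> U \<subseteq> fvec F m" using T(2,3) U(2,3) assms by auto
  have "u = lincomb F ?c (T \<union> U)" "v = lincomb F ?d (T \<union> U)"
    using lincomb_extend[OF sub(1) _ sub(2) T(4)] lincomb_extend[OF sub(1) _ sub(2) U(4)] T(1) U(1)
    by auto
  then have "(\<lambda>i. u i \<oplus> v i) = lincomb F (\<lambda>v. ?c v \<oplus> ?d v) (T \<union> U)"
    using lincomb_add[OF sub cd] by simp
  moreover have "(\<lambda>v. ?c v \<oplus> ?d v) \<in> T \<union> U \<rightarrow> carrier F" using cd by auto
  ultimately show "(\<lambda>i. u i \<oplus> v i) \<in> fspan F B"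
    unfolding fspan_def using sub(1) T(3) U(3) by blast
next
  fix a u assume a: "a \<in> carrier F" and "u \<in> fspan F B"
  then obtain c T where T: "u = lincomb F c T" "finite T" "T \<subseteq> B" "c \<in> T \<rightarrow> carrier F"
    unfolding fspan_def by blast
  have "T \<subseteq> fvec F m" using T(3) assms by blast
  then have "(\<lambda>i. a \<otimes> u i) = lincomb F (\<lambda>v. a \<otimes> c v) T"
    using lincomb_scale[OF T(2) _ T(4) a] T(1) by simp
  moreover have "(\<lambda>v. a \<otimes> c v) \<in> T \<rightarrow> carrier F" using T(4) a by auto
  ultimately show "(\<lambda>i. a \<otimes> u i) \<in> fspan F B"
    unfolding fspan_def using T(2,3) by blast
qed

section \<open>Linear independence and the cardinality of a subspace\<close>

text \<open>The difference of two coefficient functions with the same value gives a vanishing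
  combination. Extensional functions are used so that agreement on \<open>T\<close> is equality and
  the coefficient functions can be counted.\<close>

lemma lincomb_inj_on_lin_indep:
  assumes "lin_indep F T" "T \<subseteq> fvec F m"
  shows "inj_on (\<lambda>c. lincomb F c T) (T \<rightarrow>\<^sub>E carrier F)"
proof (rule inj_onI)
  fix c d assume c: "c \<in> T \<rightarrow>\<^sub>E carrier F" and d: "d \<in> T \<rightarrow>\<^sub>E carrier F"
    and eq: "lincomb F c T = lincomb F d T"
  have fin: "finite T" using assms(1) unfolding lin_indep_def by simp
  have c': "c \<in> T \<rightarrow> carrier F" and d': "d \<in> T \<rightarrow> carrier F" using c d by auto
  \<comment> \<open>Subtraction is written as scaling by \<open>\<ominus> \<one>\<close> so that the
    rules for sums and scalar multiples apply.\<close>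
  have nd: "(\<lambda>v. \<ominus> \<one> \<otimes> d v) \<in> T \<rightarrow> carrier F" using d' by auto
  have "lincomb F (\<lambda>v. c v \<oplus> \<ominus> \<one> \<otimes> d v) T
      = (\<lambda>i. lincomb F d T i \<oplus> \<ominus> \<one> \<otimes> lincomb F d T i)"
    using lincomb_add[OF fin assms(2) c' nd] lincomb_scale[OF fin assms(2) d', of "\<ominus> \<one>"] eq by simp
  also have "\<dots> = (\<lambda>i. \<zero>)"
    using lincomb_closed[OF fin assms(2) d'] by (simp add: l_minus r_neg)
  finally have "\<forall>v\<in>T. c v \<oplus> \<ominus> \<one> \<otimes> d v = \<zero>"
    using assms(1) c' nd unfolding lin_indep_def by (auto simp: Pi_iff)
  then have "c v = d v" if "v \<in> T" for v
  proof -
    have "c v \<in> carrier F" "d v \<in> carrier F" using c' d' that by auto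
    moreover have "c v \<oplus> \<ominus> d v = \<zero>"
      using bspec[OF \<open>\<forall>v\<in>T. c v \<oplus> \<ominus> \<one> \<otimes> d v = \<zero>\<close> that] calculation by (simp add: l_minus)
    ultimately show ?thesis using minus_equality minus_minus by (metis a_inv_closed)
  qed
  then show "c = d" using c d by (intro PiE_ext) auto
qed

text \<open>If the coefficient of \<open>v\<close> in a vanishing combination were nonzero, dividing
  by it would express \<open>v\<close> through \<open>T\<close>. So it is zero, and independence of
  \<open>T\<close> settles the other coefficients.\<close>

lemma lin_indep_insert:
  assumes "lin_indep F T" "insert v T \<subseteq> fvec F m" "v \<notin> fspan F T"
  shows "lin_indep F (insert v T)"
  unfolding lin_indep_def
proof (intro conjI ballI impI)
  have fin: "finite T" using assms(1) unfolding lin_indep_def by simp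
  then show "finite (insert v T)" by simp
  have vT: "v \<notin> T" using assms(2,3) fspan_superset[of T m] by auto
  fix c w assume c: "c \<in> insert v T \<rightarrow> carrier F"
    and z: "lincomb F c (insert v T) = (\<lambda>i. \<zero>)" and w: "w \<in> insert v T"
  have c': "c \<in> T \<rightarrow> carrier F" and cv: "c v \<in> carrier F" and T: "T \<subseteq> fvec F m"
    using c assms(2) by auto
  have vi: "v i \<in> carrier F" for i using assms(2) fvecD by blast
  note lc = lincomb_closed[OF fin T c']
  have z': "c v \<otimes> v i \<oplus> lincomb F c T i = \<zero>" for i
    using lincomb_insert[OF fin vT assms(2) c] z by (metis (no_types, lifting))
  have "c v = \<zero>"
  proof (rule ccontr)
    assume nz: "c v \<noteq> \<zero>"
    then have U: "c v \<in> Units F" using cv field_Units by auto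
    define a where "a = \<ominus> (inv (c v))"
    have a: "a \<in> carrier F" unfolding a_def using U by simp
    have "v i = a \<otimes> lincomb F c T i" for i
    proof -
      have "\<ominus> lincomb F c T i = c v \<otimes> v i"
        using z'[of i] lc vi cv by (intro minus_equality) auto
      then have "inv (c v) \<otimes> (\<ominus> lincomb F c T i) = v i"
        using U cv vi by (simp add: m_assoc[symmetric])
      then show ?thesis unfolding a_def using U lc by (simp add: l_minus r_minus)
    qed
    then have "v = lincomb F (\<lambda>v. a \<otimes> c v) T"
      using lincomb_scale[OF fin T c' a] by auto
    moreover have "(\<lambda>v. a \<otimes> c v) \<in> T \<rightarrow> carrier F" using a c' by auto
    ultimately show False using assms(3) fin unfolding fspan_def by blast
  qed
  moreover have "\<forall>v\<in>T. c v = \<zero>"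
  proof -
    have "lincomb F c T = (\<lambda>i. \<zero>)" using z' \<open>c v = \<zero>\<close> vi lc by (simp add: fun_eq_iff)
    then show ?thesis using assms(1) c' unfolding lin_indep_def by blast
  qed
  ultimately show "c w = \<zero>" using w by auto
qed

text \<open>An independent subset of \<open>S\<close> of maximal size spans \<open>S\<close>, since
  any vector outside its span could be added to it. The vectors of \<open>S\<close> then correspond
  to the coefficient functions on this basis.\<close>

lemma card_fsubspace:
  assumes S: "fsubspace F m S"
  shows "card S = card (carrier F) ^ vdim F S"
proof -
  note SD = fsubspaceD[OF S]
  let ?K = "{card T | T. T \<subseteq> S \<and> lin_indep F T}"
  \<comment> \<open>\<open>Max\<close> in \<open>vdim\<close> is attained only on a finite nonempty
    set: sizes are bounded by \<open>card S\<close>, and the empty set is independent.\<close>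
  have "?K \<subseteq> {..card S}" using card_mono[OF SD(3)] by auto
  then have finK: "finite ?K" by (rule finite_subset) simp
  have "lin_indep F {}" unfolding lin_indep_def by simp
  then have "?K \<noteq> {}" by blast
  from Max_in[OF finK this] obtain T where T: "T \<subseteq> S" "lin_indep F T" "vdim F S = card T"
    unfolding vdim_def by auto
  have fin: "finite T" and Tm: "T \<subseteq> fvec F m"
    using T SD(1) unfolding lin_indep_def by auto
  have "v \<in> fspan F T" if v: "v \<in> S" for v
  proof (rule ccontr)
    assume nv: "v \<notin> fspan F T"
    then have "lin_indep F (insert v T)"
      using lin_indep_insert[OF T(2) _ nv] Tm v SD(1) by auto
    then have "card (insert v T) \<in> ?K" using v T(1) by auto
    then have "card (insert v T) \<le> vdim F S" unfolding vdim_def using finK by simp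
    moreover have "v \<notin> T" using nv fspan_superset[OF Tm] by auto
    ultimately show False using fin T(3) by simp
  qed
  then have "S = fspan F T" using fspan_minimal[OF S T(1)] by auto
  also have "\<dots> = (\<lambda>c. lincomb F c T) ` (T \<rightarrow>\<^sub>E carrier F)"
  proof
    show "(\<lambda>c. lincomb F c T) ` (T \<rightarrow>\<^sub>E carrier F) \<subseteq> fspan F T"
      unfolding fspan_def using fin by blast
    show "fspan F T \<subseteq> (\<lambda>c. lincomb F c T) ` (T \<rightarrow>\<^sub>E carrier F)"
    proof
      fix v assume "v \<in> fspan F T"
      then obtain c U where U: "v = lincomb F c U" "U \<subseteq> T" "c \<in> U \<rightarrow> carrier F"
        unfolding fspan_def by blast
      \<comment> \<open>Coefficients on \<open>U\<close> are padded to all of \<open>T\<close>, then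
        restricted to become extensional.\<close>
      define d where "d = (\<lambda>v. if v \<in> U then c v else \<zero>)"
      have d: "d \<in> T \<rightarrow> carrier F" using U(3) unfolding d_def by auto
      have "v = lincomb F d T"
        unfolding d_def using lincomb_extend[OF fin U(2) Tm U(3)] U(1) by simp
      also have "\<dots> = lincomb F (restrict d T) T"
        unfolding lincomb_def using d Tm fvecD
        by (intro ext finsum_cong') (auto simp: Pi_iff subset_iff)
      finally show "v \<in> (\<lambda>c. lincomb F c T) ` (T \<rightarrow>\<^sub>E carrier F)" using d by auto
    qed
  qed
  finally have "card S = card (T \<rightarrow>\<^sub>E carrier F)"
    using card_image[OF lincomb_inj_on_lin_indep[OF T(2) Tm]] by simp
  then show ?thesis using T(3) fin by (simp add: card_PiE)
qed

section \<open>Linear maps, images and preimages\<close>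

text \<open>Linearity is required on \<open>fvec F m\<close> only; values at other functions are
  unconstrained.\<close>

definition lin_map :: "nat \<Rightarrow> nat \<Rightarrow> ((nat \<Rightarrow> 'a) \<Rightarrow> (nat \<Rightarrow> 'a)) \<Rightarrow> bool" where
  "lin_map m m' f \<longleftrightarrow> f \<in> fvec F m \<rightarrow> fvec F m' \<and>
     (\<forall>u\<in>fvec F m. \<forall>v\<in>fvec F m. f (\<lambda>i. u i \<oplus> v i) = (\<lambda>i. f u i \<oplus> f v i)) \<and>
     (\<forall>a\<in>carrier F. \<forall>v\<in>fvec F m. f (\<lambda>i. a \<otimes> v i) = (\<lambda>i. a \<otimes> f v i))"

lemma lin_mapD:
  assumes "lin_map m m' f"
  shows "\<And>v. v \<in> fvec F m \<Longrightarrow> f v \<in> fvec F m'"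
    and "\<And>u v. u \<in> fvec F m \<Longrightarrow> v \<in> fvec F m \<Longrightarrow> f (\<lambda>i. u i \<oplus> v i) = (\<lambda>i. f u i \<oplus> f v i)"
    and "\<And>a v. a \<in> carrier F \<Longrightarrow> v \<in> fvec F m \<Longrightarrow> f (\<lambda>i. a \<otimes> v i) = (\<lambda>i. a \<otimes> f v i)"
  using assms unfolding lin_map_def by blast+

lemma lin_map_zero:
  assumes "lin_map m m' f"
  shows "f (\<lambda>i. \<zero>) = (\<lambda>i. \<zero>)"
proof -
  have z: "(\<lambda>i. \<zero>) \<in> fvec F m" by (simp add: fvec_def)
  have "f (\<lambda>i. \<zero>) i \<in> carrier F" for i
    using fvecD[OF lin_mapD(1)[OF assms z]] .
  then show ?thesis using lin_mapD(3)[OF assms zero_closed z] by simp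
qed

lemma fsubspace_image:
  assumes f: "lin_map m m' f" and S: "fsubspace F m S"
  shows "fsubspace F m' (f ` S)"
  unfolding fsubspace_def
proof (intro conjI ballI)
  note SD = fsubspaceD[OF S]
  show "f ` S \<subseteq> fvec F m'" using f SD(1) unfolding lin_map_def by auto
  show "(\<lambda>i. \<zero>) \<in> f ` S" using lin_map_zero[OF f] SD(2) by (metis imageI)
  fix u assume "u \<in> f ` S"
  then obtain u' where u: "u = f u'" "u' \<in> S" by auto
  { fix v assume "v \<in> f ` S"
    then obtain v' where v: "v = f v'" "v' \<in> S" by auto
    have "(\<lambda>i. u i \<oplus> v i) = f (\<lambda>i. u' i \<oplus> v' i)"
      using lin_mapD(2)[OF f subsetD[OF SD(1) u(2)] subsetD[OF SD(1) v(2)]] u(1) v(1) by simp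
    then show "(\<lambda>i. u i \<oplus> v i) \<in> f ` S" using SD(4) u v by auto }
  { fix a assume a: "a \<in> carrier F"
    have "(\<lambda>i. a \<otimes> u i) = f (\<lambda>i. a \<otimes> u' i)"
      using lin_mapD(3)[OF f a subsetD[OF SD(1) u(2)]] u(1) by simp
    then show "(\<lambda>i. a \<otimes> u i) \<in> f ` S" using SD(5) u a by auto }
qed

lemma fsubspace_vimage:
  assumes f: "lin_map m m' f" and S: "fsubspace F m' S"
  shows "fsubspace F m {v \<in> fvec F m. f v \<in> S}"
  using fsubspaceD[OF S] fsubspaceD[OF fsubspace_fvec[of m]] f lin_map_zero[OF f]
  unfolding fsubspace_def lin_map_def by simp

text \<open>Both inclusions follow from minimality of spans: the image of a span is a subspace
  containing \<open>f\<close> B\<open>, and the preimage of the span of\<close>f \<open>B\<close> is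
  a subspace containing \<open>B\<close>.\<close>

lemma fspan_image:
  assumes f: "lin_map m m' f" and B: "B \<subseteq> fvec F m"
  shows "fspan F (f ` B) = f ` fspan F B"
proof
  have fB: "f ` B \<subseteq> fvec F m'" using f B unfolding lin_map_def by auto
  show "fspan F (f ` B) \<subseteq> f ` fspan F B"
    using fsubspace_image[OF f fsubspace_fspan[OF B]] fspan_superset[OF B]
    by (intro fspan_minimal) auto
  have "fspan F B \<subseteq> {v \<in> fvec F m. f v \<in> fspan F (f ` B)}"
    using fsubspace_vimage[OF f fsubspace_fspan[OF fB]] fspan_superset[OF fB] B
    by (intro fspan_minimal) auto
  then show "f ` fspan F B \<subseteq> fspan F (f ` B)" by auto
qed

lemma card_carrier_ge_2: "2 \<le> card (carrier F)"
proof -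
  have "card {\<zero>, \<one>} \<le> card (carrier F)"
    by (intro card_mono finite_carrier) auto
  then show ?thesis by simp
qed

section \<open>Quotient by a line\<close>

text \<open>When \<open>w j = \<ominus> \<one>\<close>, the kernel of this map is the line spanned by \<open>w\<close>, and its image lies in the
  hyperplane of vectors with vanishing coordinate \<open>j\<close>: it realises the quotient by \<open>w\<close> inside
  the same ambient space.\<close>

definition proj_along :: "nat \<Rightarrow> (nat \<Rightarrow> 'a) \<Rightarrow> (nat \<Rightarrow> 'a) \<Rightarrow> (nat \<Rightarrow> 'a)" where
  "proj_along j w v = (\<lambda>i. v i \<oplus> v j \<otimes> w i)"

lemma lin_map_proj_along:
  assumes "w \<in> fvec F m"
  shows "lin_map m m (proj_along j w)"
  unfolding lin_map_def
proof (intro conjI ballI funcsetI)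
  note w = fvecD[OF assms]
  note VD = fsubspaceD[OF fsubspace_fvec[of m]]
  fix v assume v: "v \<in> fvec F m"
  show "proj_along j w v \<in> fvec F m"
    unfolding proj_along_def using VD(4)[OF v VD(5)[OF fvecD[OF v] assms]] .
  { fix u assume u: "u \<in> fvec F m"
    show "proj_along j w (\<lambda>i. v i \<oplus> u i) = (\<lambda>i. proj_along j w v i \<oplus> proj_along j w u i)"
      unfolding proj_along_def using fvecD[OF u] fvecD[OF v] w by (simp add: l_distr a_ac) }
  { fix a assume a: "a \<in> carrier F"
    show "proj_along j w (\<lambda>i. a \<otimes> v i) = (\<lambda>i. a \<otimes> proj_along j w v i)"
      unfolding proj_along_def using a fvecD[OF v] w by (simp add: r_distr m_assoc) }
qed

text \<open>Taking away the multiple of \<open>w\<close> that the projection added recovers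
  \<open>v\<close>. Hence a vector is determined by its projection together with its coordinate
  \<open>j\<close>.\<close>

lemma proj_along_decomp:
  assumes "w \<in> fvec F m" "v \<in> fvec F m"
  shows "v = (\<lambda>i. proj_along j w v i \<oplus> (\<ominus> v j) \<otimes> w i)"
  unfolding proj_along_def
  using fvecD[OF assms(1)] fvecD[OF assms(2)] by (simp add: l_minus a_assoc r_neg)

text \<open>The kernel is the line through \<open>w\<close>, which meets \<open>S\<close> only in
  zero when \<open>w\<close> is not in \<open>S\<close>; so the projection is injective on
  \<open>S\<close>.\<close>

lemma card_proj_along_notin:
  assumes S: "fsubspace F m S" and w: "w \<in> fvec F m" "w j = \<ominus> \<one>" "w \<notin> S"
  shows "card (proj_along j w ` S) = card S"
proof (rule card_image, rule inj_onI)
  note SD = fsubspaceD[OF S]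
  note wi = fvecD[OF w(1)]
  fix u v assume u: "u \<in> S" and v: "v \<in> S" and eq: "proj_along j w u = proj_along j w v"
  define a where "a = u j \<oplus> \<ominus> v j"
  have cl: "u i \<in> carrier F" "v i \<in> carrier F" for i using u v SD(6) by auto
  have a: "a \<in> carrier F" unfolding a_def using cl by simp
  \<comment> \<open>The difference of two vectors with the same projection is the multiple
    \<open>a\<close> of \<open>w\<close>. If \<open>a\<close> were nonzero, dividing by it would put
    \<open>w\<close> into \<open>S\<close>.\<close>
  define d where "d = (\<lambda>i. v i \<oplus> \<ominus> \<one> \<otimes> u i)"
  have d: "d \<in> S" unfolding d_def using SD(4)[OF v SD(5)[OF _ u]] by simp
  have da: "d i = a \<otimes> w i" for i
  proof -
    have "v i = u i \<oplus> u j \<otimes> w i \<oplus> \<ominus> (v j) \<otimes> w i"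
      using proj_along_decomp[OF w(1), of v j] eq SD(1) v unfolding proj_along_def by (metis subsetD)
    then have "v i = u i \<oplus> a \<otimes> w i" unfolding a_def using cl wi by (simp add: l_distr a_assoc)
    then show ?thesis unfolding d_def using cl wi a
      by (simp add: l_minus r_neg2 a_comm[of "u i \<oplus> a \<otimes> w i"] r_neg1)
  qed
  have "a = \<zero>"
  proof (rule ccontr)
    assume "a \<noteq> \<zero>"
    then have U: "a \<in> Units F" using a field_Units by auto
    have "w = (\<lambda>i. inv a \<otimes> d i)"
      unfolding da using U a wi by (simp add: m_assoc[symmetric])
    then show False using SD(5)[OF _ d, of "inv a"] U w(3) by simp
  qed
  then have "d i = \<zero>" for i using da wi by simp
  then have "v i \<oplus> \<ominus> u i = \<zero>" for i unfolding d_def using cl by (simp add: l_minus)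
  then show "u = v" using cl by (intro ext) (metis a_inv_closed minus_equality minus_minus)
qed

text \<open>When the whole kernel lies in \<open>S\<close>, the projection and coordinate
  \<open>j\<close> can be prescribed independently, so each fibre has as many elements as the
  field.\<close>

lemma card_proj_along_mem:
  assumes S: "fsubspace F m S" and w: "w j = \<ominus> \<one>" "w \<in> S"
  shows "card S = card (proj_along j w ` S) * card (carrier F)"
proof -
  note SD = fsubspaceD[OF S]
  have wm: "w \<in> fvec F m" using w SD by auto
  note wi = fvecD[OF wm]
  have "bij_betw (\<lambda>v. (proj_along j w v, v j)) S (proj_along j w ` S \<times> carrier F)"
    unfolding bij_betw_def
  proof
    show "inj_on (\<lambda>v. (proj_along j w v, v j)) S"
    proof (rule inj_onI)
      fix u v assume u: "u \<in> S" and v: "v \<in> S"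
        and eq: "(proj_along j w u, u j) = (proj_along j w v, v j)"
      show "u = v"
        using proj_along_decomp[OF wm subsetD[OF SD(1) u], of j]
          proj_along_decomp[OF wm subsetD[OF SD(1) v], of j] eq by simp
    qed
    have "(proj_along j w v, a) \<in> (\<lambda>v. (proj_along j w v, v j)) ` S"
      if v: "v \<in> S" and a: "a \<in> carrier F" for v a
    proof -
      have vi: "v i \<in> carrier F" for i using v SD(6) by auto
      \<comment> \<open>Since \<open>w j = \<ominus> \<one>\<close>, adding \<open>b\<close> times
        \<open>w\<close> lowers coordinate \<open>j\<close> by \<open>b\<close>, which makes it
        \<open>a\<close>, and leaves the projection unchanged.\<close>
      define b where "b = v j \<oplus> \<ominus> a"
      have b: "b \<in> carrier F" unfolding b_def using vi a by simp
      define v' where "v' = (\<lambda>i. v i \<oplus> b \<otimes> w i)"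
      have "v' \<in> S" unfolding v'_def using SD(4)[OF v SD(5)[OF b w(2)]] .
      moreover have v'j: "v' j = a"
        unfolding v'_def b_def using vi a w(1) by (simp add: r_minus minus_add minus_minus r_neg2)
      moreover have "proj_along j w v' = proj_along j w v"
      proof
        fix i
        have "b \<oplus> a = v j" unfolding b_def using vi a by (simp add: a_assoc l_neg)
        then have "b \<otimes> w i \<oplus> a \<otimes> w i = v j \<otimes> w i" using b a wi by (metis l_distr)
        then show "proj_along j w v' i = proj_along j w v i"
          unfolding proj_along_def v'j unfolding v'_def using vi b a wi by (simp add: a_assoc)
      qed
      ultimately show ?thesis by (metis (mono_tags, lifting) imageI)
    qed
    then show "(\<lambda>v. (proj_along j w v, v j)) ` S = proj_along j w ` S \<times> carrier F"
      using SD(6) by auto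
  qed
  from bij_betw_same_card[OF this] show ?thesis by (simp add: card_cartesian_product)
qed

section \<open>Direct sums of subspaces\<close>

definition vappend :: "nat \<Rightarrow> (nat \<Rightarrow> 'a) \<Rightarrow> (nat \<Rightarrow> 'a) \<Rightarrow> (nat \<Rightarrow> 'a)" where
  "vappend m u v = (\<lambda>i. if i < m then u i else v (i - m))"

text \<open>This is the external direct sum, realised by concatenating coordinate vectors inside
  \<open>fvec F (m + m')\<close> when \<open>S\<close> and \<open>T\<close> are subspaces of
  \<open>fvec F m\<close> and \<open>fvec F m'\<close>.\<close>

definition dsum :: "nat \<Rightarrow> (nat \<Rightarrow> 'a) set \<Rightarrow> (nat \<Rightarrow> 'a) set \<Rightarrow> (nat \<Rightarrow> 'a) set" where
  "dsum m S T = (\<lambda>(u, v). vappend m u v) ` (S \<times> T)"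

lemma vappend_eqD:
  assumes "u \<in> fvec F m" "u' \<in> fvec F m" "vappend m u v = vappend m u' v'"
  shows "u = u'" "v = v'"
proof -
  have eq: "vappend m u v i = vappend m u' v' i" for i using assms(3) by simp
  have "u i = u' i" for i using eq[of i] assms(1,2) unfolding vappend_def fvec_def
    by (cases "i < m") auto
  then show "u = u'" by auto
  have "v i = v' i" for i using eq[of "i + m"] unfolding vappend_def by simp
  then show "v = v'" by auto
qed

lemma card_dsum:
  assumes "S \<subseteq> fvec F m"
  shows "card (dsum m S T) = card S * card T"
proof -
  have "inj_on (\<lambda>(u, v). vappend m u v) (S \<times> T)"
  proof (rule inj_onI)
    fix x y assume x: "x \<in> S \<times> T" and y: "y \<in> S \<times> T"
      and eq: "(case x of (u, v) \<Rightarrow> vappend m u v) = (case y of (u, v) \<Rightarrow> vappend m u v)"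
    have "fst x \<in> fvec F m" "fst y \<in> fvec F m" using x y assms by auto
    moreover have "vappend m (fst x) (snd x) = vappend m (fst y) (snd y)"
      using eq by (simp add: case_prod_beta)
    ultimately show "x = y" using vappend_eqD by (metis prod.expand)
  qed
  then show ?thesis unfolding dsum_def by (simp add: card_image card_cartesian_product)
qed

lemma dsumI: "u \<in> S \<Longrightarrow> v \<in> T \<Longrightarrow> vappend m u v \<in> dsum m S T"
  unfolding dsum_def by auto

lemma fsubspace_dsum:
  assumes S: "fsubspace F m S" and T: "fsubspace F m' T"
  shows "fsubspace F (m + m') (dsum m S T)"
  unfolding fsubspace_def
proof (intro conjI ballI)
  note SD = fsubspaceD[OF S] and TD = fsubspaceD[OF T]
  show "dsum m S T \<subseteq> fvec F (m + m')"
    using SD(1) TD(1) unfolding dsum_def vappend_def fvec_def by fastforce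
  have "vappend m (\<lambda>i. \<zero>) (\<lambda>i. \<zero>) = (\<lambda>i. \<zero>)" unfolding vappend_def by auto
  then show "(\<lambda>i. \<zero>) \<in> dsum m S T" using dsumI[OF SD(2) TD(2), of m] by simp
  fix x assume "x \<in> dsum m S T"
  then obtain u v where x: "x = vappend m u v" "u \<in> S" "v \<in> T" unfolding dsum_def by auto
  { fix y assume "y \<in> dsum m S T"
    then obtain u' v' where y: "y = vappend m u' v'" "u' \<in> S" "v' \<in> T" unfolding dsum_def by auto
    have "(\<lambda>i. x i \<oplus> y i) = vappend m (\<lambda>i. u i \<oplus> u' i) (\<lambda>i. v i \<oplus> v' i)"
      unfolding x y vappend_def by auto
    then show "(\<lambda>i. x i \<oplus> y i) \<in> dsum m S T"
      using dsumI[OF SD(4)[OF x(2) y(2)] TD(4)[OF x(3) y(3)]] by simp }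
  { fix a assume a: "a \<in> carrier F"
    have "(\<lambda>i. a \<otimes> x i) = vappend m (\<lambda>i. a \<otimes> u i) (\<lambda>i. a \<otimes> v i)"
      unfolding x vappend_def by auto
    then show "(\<lambda>i. a \<otimes> x i) \<in> dsum m S T"
      using dsumI[OF SD(5)[OF a x(2)] TD(5)[OF a x(3)]] by simp }
qed

lemma lin_map_vappend_left: "lin_map m (m + m') (\<lambda>u. vappend m u (\<lambda>i. \<zero>))"
  unfolding lin_map_def vappend_def by (auto simp: fvec_def)

lemma lin_map_vappend_right: "lin_map m' (m + m') (vappend m (\<lambda>i. \<zero>))"
  unfolding lin_map_def vappend_def by (auto simp: fvec_def)

text \<open>From left to right, the right side is a subspace containing the generators. Conversely,
  each \<open>V x\<close> and \<open>W x\<close> contains zero, so the zero-padded copies of both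
  spans lie in the left side, and every concatenation is a sum of two such vectors.\<close>

lemma fspan_dsum:
  assumes V: "\<And>x. x \<in> A \<Longrightarrow> fsubspace F m (V x)" and W: "\<And>x. x \<in> A \<Longrightarrow> fsubspace F m' (W x)"
  shows "fspan F (\<Union>x\<in>A. dsum m (V x) (W x)) = dsum m (fspan F (\<Union>x\<in>A. V x)) (fspan F (\<Union>x\<in>A. W x))"
    (is "fspan F ?D = dsum m (fspan F ?V) (fspan F ?W)")
proof
  have Vm: "?V \<subseteq> fvec F m" and Wm: "?W \<subseteq> fvec F m'"
    using fsubspaceD(1)[OF V] fsubspaceD(1)[OF W] by blast+
  have Dm: "?D \<subseteq> fvec F (m + m')"
    using fsubspaceD(1)[OF fsubspace_dsum[OF V W]] by blast
  note D = fsubspace_fspan[OF Dm]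
  show "fspan F ?D \<subseteq> dsum m (fspan F ?V) (fspan F ?W)"
  proof (rule fspan_minimal[OF fsubspace_dsum[OF fsubspace_fspan[OF Vm] fsubspace_fspan[OF Wm]]])
    show "?D \<subseteq> dsum m (fspan F ?V) (fspan F ?W)"
      using fspan_superset[OF Vm] fspan_superset[OF Wm] unfolding dsum_def by fastforce
  qed
  have "fspan F ?V \<subseteq> {u \<in> fvec F m. vappend m u (\<lambda>i. \<zero>) \<in> fspan F ?D}"
  proof (rule fspan_minimal[OF fsubspace_vimage[OF lin_map_vappend_left D]])
    show "?V \<subseteq> {u \<in> fvec F m. vappend m u (\<lambda>i. \<zero>) \<in> fspan F ?D}"
      using Vm dsumI[OF _ fsubspaceD(2)[OF W]] fspan_superset[OF Dm] by blast
  qed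
  moreover have "fspan F ?W \<subseteq> {v \<in> fvec F m'. vappend m (\<lambda>i. \<zero>) v \<in> fspan F ?D}"
  proof (rule fspan_minimal[OF fsubspace_vimage[OF lin_map_vappend_right D]])
    show "?W \<subseteq> {v \<in> fvec F m'. vappend m (\<lambda>i. \<zero>) v \<in> fspan F ?D}"
      using Wm dsumI[OF fsubspaceD(2)[OF V]] fspan_superset[OF Dm] by blast
  qed
  moreover have "vappend m u v = (\<lambda>i. vappend m u (\<lambda>i. \<zero>) i \<oplus> vappend m (\<lambda>i. \<zero>) v i)"
    if "u \<in> fvec F m" "v \<in> fvec F m'" for u v
    using fvecD[OF that(1)] fvecD[OF that(2)] unfolding vappend_def by auto
  ultimately show "dsum m (fspan F ?V) (fspan F ?W) \<subseteq> fspan F ?D"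
    using fsubspaceD(4)[OF D] unfolding dsum_def by fastforce
qed

section \<open>Rank functions represented over the fixed field\<close>

text \<open>The dimension of a span is recorded through its cardinality, a power of the field size.\<close>

definition frep :: "'x set \<Rightarrow> ('x set \<Rightarrow> nat) \<Rightarrow> bool" where
  "frep X r \<longleftrightarrow> (\<exists>m V. (\<forall>x\<in>X. fsubspace F m (V x)) \<and>
     (\<forall>A. A \<subseteq> X \<longrightarrow> card (fspan F (\<Union>x\<in>A. V x)) = card (carrier F) ^ r A))"

text \<open>The representation is the direct sum of \<open>N\<close> copies of the given one. Large
  \<open>N\<close> makes a truncation error that depends only on \<open>card X\<close> small
  relative to the ranks.\<close>

lemma frep_multiple:
  fixes X :: "'x set"
  assumes "frep X r"
  shows "frep X (\<lambda>A. N * r A)"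
proof (induction N)
  case 0
  \<comment> \<open>Zero copies live in the ambient space of dimension 0, where every span consists
    of the zero vector.\<close>
  have z: "fvec F 0 = {\<lambda>i. \<zero>}" by (auto simp: fvec_def)
  have "card (fspan F (\<Union>x\<in>A. fvec F 0)) = 1" for A :: "'x set"
  proof -
    have "fsubspace F 0 (fspan F (\<Union>x\<in>A. fvec F 0))" by (rule fsubspace_fspan) auto
    from fsubspaceD(1,2)[OF this] have "fspan F (\<Union>x\<in>A. fvec F 0) = {\<lambda>i. \<zero>}" using z by blast
    then show ?thesis by simp
  qed
  then show ?case unfolding frep_def using fsubspace_fvec[of 0]
    by (intro exI[of _ 0] exI[of _ "\<lambda>_. fvec F 0"]) (simp del: UN_constant)
next
  case (Suc N)
  obtain m V where V: "\<And>x. x \<in> X \<Longrightarrow> fsubspace F m (V x)"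
    "\<And>A. A \<subseteq> X \<Longrightarrow> card (fspan F (\<Union>x\<in>A. V x)) = card (carrier F) ^ r A"
    using assms unfolding frep_def by blast
  obtain m' W where W: "\<And>x. x \<in> X \<Longrightarrow> fsubspace F m' (W x)"
    "\<And>A. A \<subseteq> X \<Longrightarrow> card (fspan F (\<Union>x\<in>A. W x)) = card (carrier F) ^ (N * r A)"
    using Suc unfolding frep_def by blast
  have "card (fspan F (\<Union>x\<in>A. dsum m (V x) (W x))) = card (carrier F) ^ (Suc N * r A)"
    if A: "A \<subseteq> X" for A
  proof -
    have "(\<Union>x\<in>A. V x) \<subseteq> fvec F m" using fsubspaceD(1)[OF V(1)] A by blast
    then have "fspan F (\<Union>x\<in>A. V x) \<subseteq> fvec F m" by (intro fspan_minimal[OF fsubspace_fvec])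
    moreover have "fspan F (\<Union>x\<in>A. dsum m (V x) (W x))
        = dsum m (fspan F (\<Union>x\<in>A. V x)) (fspan F (\<Union>x\<in>A. W x))"
      using A V(1) W(1) by (intro fspan_dsum) auto
    ultimately show ?thesis using V(2)[OF A] W(2)[OF A] by (simp add: card_dsum power_add)
  qed
  then show ?case unfolding frep_def using fsubspace_dsum[OF V(1) W(1)]
    by (intro exI[of _ "m + m'"] exI[of _ "\<lambda>x. dsum m (V x) (W x)"]) simp
qed

lemma frep_mono:
  assumes "frep X r" "A \<subseteq> X"
  shows "r A \<le> r X"
proof -
  obtain m V where V: "\<And>x. x \<in> X \<Longrightarrow> fsubspace F m (V x)"
    "\<And>A. A \<subseteq> X \<Longrightarrow> card (fspan F (\<Union>x\<in>A. V x)) = card (carrier F) ^ r A"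
    using assms unfolding frep_def by blast
  have "(\<Union>x\<in>X. V x) \<subseteq> fvec F m" using fsubspaceD(1)[OF V(1)] by blast
  then have "finite (fspan F (\<Union>x\<in>X. V x))" using fsubspaceD(3)[OF fsubspace_fspan] by blast
  moreover have "fspan F (\<Union>x\<in>A. V x) \<subseteq> fspan F (\<Union>x\<in>X. V x)"
    using assms(2) by (intro fspan_mono) auto
  ultimately have "card (fspan F (\<Union>x\<in>A. V x)) \<le> card (fspan F (\<Union>x\<in>X. V x))"
    by (rule card_mono)
  then have "card (carrier F) ^ r A \<le> card (carrier F) ^ r X"
    using V(2)[OF assms(2)] V(2)[of X] by simp
  then show ?thesis using card_carrier_ge_2 by (simp add: power_le_imp_le_exp)
qed

section \<open>Approximate truncation by repeated quotients\<close>

text \<open>Dividing by a vector \<open>w\<close> of the full span lowers by one exactly the ranks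
  of the spans that contain \<open>w\<close>. Counting provides a nonzero \<open>w\<close> outside
  every span of corank greater than \<open>card X\<close>, so only ranks close to the top can
  drop.\<close>

lemma frep_quotient:
  assumes "finite X" "frep X r" "0 < r X"
  shows "\<exists>r'. frep X r' \<and> r' X = r X - 1 \<and>
    (\<forall>A. A \<subseteq> X \<longrightarrow> r' A \<le> r A \<and> r A \<le> r' A + 1 \<and> (r A + card X + 1 \<le> r X \<longrightarrow> r' A = r A))"
proof -
  let ?q = "card (carrier F)"
  note q = card_carrier_ge_2
  obtain m V where V: "\<And>x. x \<in> X \<Longrightarrow> fsubspace F m (V x)"
    and cV: "\<And>A. A \<subseteq> X \<Longrightarrow> card (fspan F (\<Union>x\<in>A. V x)) = ?q ^ r A"
    using assms unfolding frep_def by blast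
  define S where "S A = fspan F (\<Union>x\<in>A. V x)" for A
  have Vm: "(\<Union>x\<in>A. V x) \<subseteq> fvec F m" if "A \<subseteq> X" for A
    using fsubspaceD(1)[OF V] that by blast
  have S: "fsubspace F m (S A)" if "A \<subseteq> X" for A
    unfolding S_def using fsubspace_fspan[OF Vm[OF that]] .
  have cS: "card (S A) = ?q ^ r A" if "A \<subseteq> X" for A
    unfolding S_def using cV[OF that] .
  define Bad where "Bad = {A. A \<subseteq> X \<and> r A + card X + 1 \<le> r X}"
  have finBad: "finite Bad" and cBad: "card Bad \<le> 2 ^ card X"
  proof -
    have "Bad \<subseteq> Pow X" unfolding Bad_def by auto
    then show "finite Bad" "card Bad \<le> 2 ^ card X"
      using assms(1) finite_subset card_mono[of "Pow X" Bad] by (auto simp: card_Pow)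
  qed
  \<comment> \<open>The zero vector is included to ensure that the vector chosen outside
    \<open>Z\<close> is nonzero.\<close>
  define Z where "Z = insert (\<lambda>i. \<zero>) (\<Union>A\<in>Bad. S A)"
  have "card Z < card (S X)"
  proof (cases "Bad = {}")
    case True
    have "1 < ?q ^ r X" using q assms(3) by (intro one_less_power) auto
    then show ?thesis using True cS[of X] by (simp add: Z_def)
  next
    case False
    then obtain B where B: "B \<in> Bad" by auto
    then have n: "card X + 1 \<le> r X" unfolding Bad_def by auto
    \<comment> \<open>Zero already lies in a bad span, so it does not enlarge the union to be
      counted.\<close>
    have "(\<lambda>i. \<zero>) \<in> S B" using fsubspaceD(2)[OF S] B unfolding Bad_def by auto
    then have "Z = (\<Union>A\<in>Bad. S A)" using B unfolding Z_def by auto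
    then have "card Z \<le> (\<Sum>A\<in>Bad. card (S A))" using card_UN_le[OF finBad] by simp
    also have "\<dots> \<le> (\<Sum>A\<in>Bad. ?q ^ (r X - card X - 1))"
    proof (rule sum_mono)
      fix A assume "A \<in> Bad"
      then show "card (S A) \<le> ?q ^ (r X - card X - 1)"
        unfolding Bad_def using cS q by (auto intro!: power_increasing)
    qed
    also have "\<dots> \<le> 2 ^ card X * ?q ^ (r X - card X - 1)" using cBad by simp
    \<comment> \<open>The field has at least two elements, so the number of bad spans is at most
      \<open>?q ^ card X\<close>. This is why a corank of at least \<open>card X + 1\<close> was
      demanded: one factor \<open>?q\<close> is left over.\<close>
    also have "\<dots> \<le> ?q ^ card X * ?q ^ (r X - card X - 1)"
      using q by (intro mult_right_mono power_mono) auto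
    also have "\<dots> = ?q ^ (r X - 1)" using n by (simp flip: power_add)
    also have "\<dots> < ?q ^ r X" using q assms(3) by (intro power_strict_increasing) auto
    finally show ?thesis using cS[of X] by simp
  qed
  moreover have "finite Z"
    unfolding Z_def using finBad fsubspaceD(3)[OF S] by (auto simp: Bad_def)
  ultimately obtain u where u: "u \<in> S X" "u \<notin> Z" using card_mono[of Z "S X"] by force
  have um: "u \<in> fvec F m" using u(1) fsubspaceD(1)[OF S] by auto
  note ui = fvecD[OF um]
  from u(2) obtain j where j: "u j \<noteq> \<zero>" unfolding Z_def by auto
  then have uU: "u j \<in> Units F" using ui field_Units by auto
  \<comment> \<open>Rescaling \<open>u\<close> achieves \<open>w j = \<ominus> \<one>\<close>, the
    normalisation under which \<open>proj_along j w\<close> has kernel spanned by \<open>w\<close>.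
    Membership in subspaces is not affected.\<close>
  define w where "w = (\<lambda>i. \<ominus> (inv (u j)) \<otimes> u i)"
  have wX: "w \<in> S X" unfolding w_def using fsubspaceD(5)[OF S] u(1) uU by auto
  then have wm: "w \<in> fvec F m" using fsubspaceD(1)[OF S] by auto
  have wj: "w j = \<ominus> \<one>" unfolding w_def using uU ui by (simp add: l_minus)
  have u_w: "u = (\<lambda>i. \<ominus> u j \<otimes> w i)"
    unfolding w_def using uU ui by (simp add: l_minus r_minus m_assoc[symmetric])
  have w_bad: "w \<notin> S A" if "A \<in> Bad" for A
  proof
    assume "w \<in> S A"
    then have "u \<in> S A"
      using fsubspaceD(5)[OF S, of A "\<ominus> u j" w] u_w that ui unfolding Bad_def by auto
    then show False using u(2) that unfolding Z_def by auto
  qed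
  \<comment> \<open>The natural subtraction is a true one: a span containing the nonzero vector
    \<open>w\<close> has positive rank, as \<open>pos\<close> shows.\<close>
  define r' where "r' A = (if w \<in> S A then r A - 1 else r A)" for A
  have card': "card (fspan F (\<Union>x\<in>A. proj_along j w ` V x)) = ?q ^ r' A"
    and pos: "w \<in> S A \<Longrightarrow> 0 < r A" if A: "A \<subseteq> X" for A
  proof -
    have *: "card (S A) = card (proj_along j w ` S A) * ?q" if "w \<in> S A"
      using card_proj_along_mem[OF S[OF A] wj that] .
    show p: "0 < r A" if "w \<in> S A" using *[OF that] cS[OF A] q by (cases "r A") auto
    have "fspan F (\<Union>x\<in>A. proj_along j w ` V x) = proj_along j w ` S A"
      unfolding S_def using fspan_image[OF lin_map_proj_along[OF wm] Vm[OF A]]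
      by (simp add: image_UN)
    moreover have "card (proj_along j w ` S A) = ?q ^ r' A"
    proof (cases "w \<in> S A")
      case True
      then have "card (proj_along j w ` S A) * ?q = ?q ^ (r A - 1) * ?q"
        using *[OF True] cS[OF A] p[OF True] by (metis power_minus_mult)
      then show ?thesis using True q by (simp add: r'_def)
    next
      case False
      then show ?thesis using card_proj_along_notin[OF S[OF A] wm wj] cS[OF A] by (simp add: r'_def)
    qed
    ultimately show "card (fspan F (\<Union>x\<in>A. proj_along j w ` V x)) = ?q ^ r' A" by simp
  qed
  have "frep X r'"
    unfolding frep_def using card' fsubspace_image[OF lin_map_proj_along[OF wm] V]
    by (intro exI[of _ m] exI[of _ "\<lambda>x. proj_along j w ` V x"]) simp
  moreover have "r' X = r X - 1" using wX by (simp add: r'_def)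
  ultimately show ?thesis
    using w_bad by (intro exI[of _ r']) (auto simp: r'_def Bad_def)
qed

text \<open>The quotient step is iterated \<open>t\<close> times. A rank first drops when its corank
  is at most \<open>card X\<close>. Each step lowers the top rank by exactly one and any other by at
  most one, so coranks never grow and the bound persists.\<close>

lemma frep_truncate:
  assumes "finite X" "frep X r" "t \<le> r X"
  shows "\<exists>r'. frep X r' \<and> r' X = r X - t \<and>
    (\<forall>A. A \<subseteq> X \<longrightarrow> r' A \<le> r A \<and> (r' A = r A \<or> r X \<le> r' A + t + card X))"
  using assms(3)
proof (induction t)
  case 0
  then show ?case using assms(2) by auto
next
  case (Suc t)
  then obtain r1 where r1: "frep X r1" "r1 X = r X - t"
    "\<And>A. A \<subseteq> X \<Longrightarrow> r1 A \<le> r A \<and> (r1 A = r A \<or> r X \<le> r1 A + t + card X)" by auto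
  obtain r2 where r2: "frep X r2" "r2 X = r1 X - 1"
    "\<And>A. A \<subseteq> X \<Longrightarrow> r2 A \<le> r1 A \<and> r1 A \<le> r2 A + 1 \<and> (r1 A + card X + 1 \<le> r1 X \<longrightarrow> r2 A = r1 A)"
    using frep_quotient[OF assms(1) r1(1)] r1(2) Suc.prems by auto
  have "r2 A \<le> r A \<and> (r2 A = r A \<or> r X \<le> r2 A + Suc t + card X)" if "A \<subseteq> X" for A
    using r1(3)[OF that] r2(3)[OF that] r1(2) by auto
  moreover have "r2 X = r X - Suc t" using r1(2) r2(2) by simp
  ultimately show ?case using r2(1) by blast
qed

section \<open>Translation between cardinalities and dimensions\<close>

lemma frep_vdim:
  assumes "\<forall>x\<in>X. fsubspace F m (V x)"
  shows "frep X (\<lambda>A. vdim F (fspan F (\<Union>x\<in>A. V x)))"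
proof -
  have "card (fspan F (\<Union>x\<in>A. V x)) = card (carrier F) ^ vdim F (fspan F (\<Union>x\<in>A. V x))"
    if "A \<subseteq> X" for A
  proof -
    have "(\<Union>x\<in>A. V x) \<subseteq> fvec F m" using assms that unfolding fsubspace_def by blast
    then show ?thesis by (intro card_fsubspace[OF fsubspace_fspan])
  qed
  then show ?thesis unfolding frep_def using assms by blast
qed

lemma frep_obtain:
  assumes "frep X r"
  obtains m V where "\<forall>x\<in>X. fsubspace F m (V x)"
    and "\<And>A. A \<subseteq> X \<Longrightarrow> r A = vdim F (fspan F (\<Union>x\<in>A. V x))"
proof -
  obtain m V where V: "\<forall>x\<in>X. fsubspace F m (V x)"
    and cV: "\<And>A. A \<subseteq> X \<Longrightarrow> card (fspan F (\<Union>x\<in>A. V x)) = card (carrier F) ^ r A"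
    using assms unfolding frep_def by blast
  have "r A = vdim F (fspan F (\<Union>x\<in>A. V x))" if "A \<subseteq> X" for A
  proof -
    have "(\<Union>x\<in>A. V x) \<subseteq> fvec F m" using V that unfolding fsubspace_def by blast
    from cV[OF that] card_fsubspace[OF fsubspace_fspan[OF this]] show ?thesis
      using card_carrier_ge_2 by (simp add: power_inject_exp)
  qed
  then show ?thesis using that V by blast
qed

end

section \<open>Truncation of representable functions and passage to the limit\<close>

text \<open>Here \<open>s\<close> is the integer truncation level. The top rank is hit exactly, and
  elsewhere the only error is a deficit of at most \<open>card X\<close>, independent of
  \<open>N\<close>.\<close>

lemma representable_truncate_multiple:
  assumes "finite X" "representable X g"
  shows "\<exists>g'. representable X g' \<and>
    (\<forall>A. A \<subseteq> X \<longrightarrow> min (real N * g A) (min (real s) (real N * g X) - real (card X)) \<le> g' A \<and>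
       g' A \<le> min (real N * g A) (min (real s) (real N * g X)))"
proof -
  obtain F :: "nat ring" and m V where F: "field F" "finite (carrier F)"
    and V: "\<forall>x\<in>X. fsubspace F m (V x)"
    and g: "\<And>A. A \<subseteq> X \<Longrightarrow> g A = real (vdim F (fspan F (\<Union>x\<in>A. V x)))"
    using assms(2) unfolding representable_def by blast
  interpret fin_field F using F by (simp add: fin_field_def fin_field_axioms_def)
  define r where "r = (\<lambda>A. N * vdim F (fspan F (\<Union>x\<in>A. V x)))"
  have r: "frep X r" unfolding r_def by (rule frep_multiple[OF frep_vdim[OF V]])
  have gr: "real N * g A = real (r A)" if "A \<subseteq> X" for A using g[OF that] by (simp add: r_def)
  \<comment> \<open>If \<open>s\<close> exceeds \<open>r X\<close>, the number
    \<open>r X - s\<close> of quotients is 0 and nothing is cut off; in every case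
    \<open>r' X\<close> is the minimum of \<open>r X\<close> and \<open>s\<close>.\<close>
  obtain r' where r': "frep X r'" "r' X = r X - (r X - s)"
    "\<And>A. A \<subseteq> X \<Longrightarrow> r' A \<le> r A \<and> (r' A = r A \<or> r X \<le> r' A + (r X - s) + card X)"
    using frep_truncate[OF assms(1) r, of "r X - s"] by auto
  obtain m' V' where V': "\<forall>x\<in>X. fsubspace F m' (V' x)"
    "\<And>A. A \<subseteq> X \<Longrightarrow> r' A = vdim F (fspan F (\<Union>x\<in>A. V' x))"
    using frep_obtain[OF r'(1)] by blast
  have "representable X (\<lambda>A. real (r' A))"
    unfolding representable_def
    by (intro exI[of _ F] exI[of _ m'] exI[of _ V'] conjI) (use F V' in auto)
  moreover have "min (real N * g A) (min (real s) (real N * g X) - real (card X)) \<le> real (r' A) \<and>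
       real (r' A) \<le> min (real N * g A) (min (real s) (real N * g X))" if A: "A \<subseteq> X" for A
    using r'(3)[OF A] r'(2) frep_mono[OF r'(1) A] gr[OF A] gr[of X] by auto
  ultimately show ?thesis by (intro exI[of _ "\<lambda>A. real (r' A)"]) auto
qed

theorem theorem3:
  fixes X :: "'x set" and h :: "'x set \<Rightarrow> real" and \<epsilon> :: real
  assumes "finite X"
    and "polymatroid X h"
    and "almost_representable X h"
    and "0 \<le> \<epsilon>" and "\<epsilon> \<le> h X"
  shows "almost_representable X (\<lambda>A. min (h A) (h X - \<epsilon>))"
proof -
  define \<kappa> where "\<kappa> = h X - \<epsilon>"
  have \<kappa>: "0 \<le> \<kappa>" "\<kappa> \<le> h X" using assms(4,5) by (auto simp: \<kappa>_def)
  obtain g c where g: "\<And>i. representable X (g i)" and c: "\<And>i. 0 < c i"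
    and lim: "\<And>A. A \<subseteq> X \<Longrightarrow> (\<lambda>i. c i * g i A) \<longlonglongrightarrow> h A"
    using assms(3) unfolding almost_representable_def by blast
  \<comment> \<open>The ceiling forces \<open>c i / N i\<close> below \<open>1 / (i + 1)\<close>,
    whatever the behaviour of \<open>c\<close>, and \<open>Suc\<close> keeps the number of copies
    positive.\<close>
  define N where "N i = Suc (nat \<lceil>c i * real (Suc i)\<rceil>)" for i
  define d where "d i = c i / real (N i)" for i
  have N0: "0 < real (N i)" for i by (simp add: N_def)
  have d0: "0 < d i" for i using c N0 by (simp add: d_def)
  have d1: "d i \<le> inverse (real (Suc i))" for i
  proof -
    have "c i * real (Suc i) \<le> real (N i)" unfolding N_def by linarith
    then show ?thesis using N0[of i] by (simp add: d_def field_simps)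
  qed
  have dlim: "d \<longlonglongrightarrow> 0"
    by (rule tendsto_sandwich[OF _ _ tendsto_const LIMSEQ_inverse_real_of_nat])
      (use d0 d1 in \<open>auto intro!: always_eventually less_imp_le simp del: of_nat_Suc\<close>)
  \<comment> \<open>The level \<open>s i\<close> is the largest integer whose multiple by
    \<open>d i\<close> does not exceed \<kappa>; rounding costs at most \<open>d i\<close> after
    scaling.\<close>
  define s where "s i = nat \<lfloor>\<kappa> / d i\<rfloor>" for i
  have s: "\<kappa> - d i \<le> d i * real (s i)" "d i * real (s i) \<le> \<kappa>" for i
  proof -
    have "0 \<le> \<kappa> / d i" using \<kappa>(1) d0[of i] by simp
    then have "\<kappa> / d i - 1 \<le> real (s i)" "real (s i) \<le> \<kappa> / d i" unfolding s_def by linarith+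
    then show "\<kappa> - d i \<le> d i * real (s i)" "d i * real (s i) \<le> \<kappa>"
      using d0[of i] by (simp_all add: field_simps)
  qed
  have slim: "(\<lambda>i. d i * real (s i)) \<longlonglongrightarrow> \<kappa>"
    by (rule tendsto_sandwich[of "\<lambda>i. \<kappa> - d i" _ _ "\<lambda>_. \<kappa>"])
      (use s tendsto_diff[OF tendsto_const dlim, of \<kappa>] in auto)
  have "\<forall>i. \<exists>g'. representable X g' \<and>
    (\<forall>A. A \<subseteq> X \<longrightarrow> min (real (N i) * g i A) (min (real (s i)) (real (N i) * g i X) - real (card X)) \<le> g' A \<and>
       g' A \<le> min (real (N i) * g i A) (min (real (s i)) (real (N i) * g i X)))"
    using representable_truncate_multiple[OF assms(1) g] by blast
  then obtain g' where g': "\<And>i. representable X (g' i)"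
    and lo: "\<And>i A. A \<subseteq> X \<Longrightarrow>
      min (real (N i) * g i A) (min (real (s i)) (real (N i) * g i X) - real (card X)) \<le> g' i A"
    and hi: "\<And>i A. A \<subseteq> X \<Longrightarrow>
      g' i A \<le> min (real (N i) * g i A) (min (real (s i)) (real (N i) * g i X))"
    by metis
  \<comment> \<open>Scaling by \<open>d i\<close> undoes the passage to \<open>N i\<close> copies,
    so the scaled ranks are the original approximants of \<open>h\<close>.\<close>
  have dN: "d i * (real (N i) * x) = c i * x" for i x using N0[of i] by (simp add: d_def)
  have "(\<lambda>i. d i * g' i A) \<longlonglongrightarrow> min (h A) \<kappa>" if A: "A \<subseteq> X" for A
  proof (rule tendsto_sandwich)
    \<comment> \<open>The scaled top rank of the truncated function; it tends to the minimum of
      \<kappa> and \<open>h X\<close>, which is \<kappa>. The lower bound of the sandwich differs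
      from the upper one only by the scaled deficit \<open>d i * real (card X)\<close>, which tends
      to 0.\<close>
    let ?b = "\<lambda>i. min (d i * real (s i)) (c i * g i X)"
    have b: "?b \<longlonglongrightarrow> \<kappa>"
      using tendsto_min[OF slim lim[of X]] \<kappa>(2) by (simp add: min_absorb1)
    have "(\<lambda>i. d i * real (card X)) \<longlonglongrightarrow> 0" using tendsto_mult_right[OF dlim] by simp
    from tendsto_min[OF lim[OF A] tendsto_diff[OF b this]]
    show "(\<lambda>i. min (c i * g i A) (?b i - d i * real (card X))) \<longlonglongrightarrow> min (h A) \<kappa>" by simp
    show "(\<lambda>i. min (c i * g i A) (?b i)) \<longlonglongrightarrow> min (h A) \<kappa>"
      using tendsto_min[OF lim[OF A] b] .
    show "\<forall>\<^sub>F i in sequentially. min (c i * g i A) (?b i - d i * real (card X)) \<le> d i * g' i A"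
    proof (rule always_eventually, rule allI)
      fix i
      show "min (c i * g i A) (?b i - d i * real (card X)) \<le> d i * g' i A"
        using mult_left_mono[OF lo[OF A] less_imp_le[OF d0], of i i] d0[of i]
        by (simp add: min_mult_distrib_left right_diff_distrib dN)
    qed
    show "\<forall>\<^sub>F i in sequentially. d i * g' i A \<le> min (c i * g i A) (?b i)"
    proof (rule always_eventually, rule allI)
      fix i
      show "d i * g' i A \<le> min (c i * g i A) (?b i)"
        using mult_left_mono[OF hi[OF A] less_imp_le[OF d0], of i i] d0[of i]
        by (simp add: min_mult_distrib_left dN)
    qed
  qed
  then show ?thesis unfolding almost_representable_def \<kappa>_def[symmetric] using g' d0 by blast
qed

end
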